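(* There exists a non-negative integer $n_0$ such that $$\left|\alpha-\frac{a_{n+1}}{a_n}\right|\ \ge\ \left|\alpha-\frac{a_{n+2}}{a_{n+1}}\right|\qquad\text{for all } n\ge n_0$$ if and only if $a^2-4b\ge 0$.
   Context: Let $a,b\in\mathbb{R}$ with $ab\neq 0$, and let $(c_0,c_1)\in\mathbb{R}^2$ with $(c_0,c_1)\neq(0,0)$. Let $(a_n)_{n\ge 0}$ be the real sequence defined by $a_0=c_0$, $a_1=c_1$ and $a_{n+2}-a\,a_{n+1}+b\,a_n=0$ for all $n\ge 0$. Put $\alpha_\pm=\frac{a\pm\sqrt{a^2-4b}}{2}$, the roots of $x^2-ax+b$, where $\sqrt{a^2-4b}=\sqrt{-1}\,\sqrt{4b-a^2}$ if $a^2-4b<0$. Let $\alpha,\beta$ denote these two roots labelled so that $\{\alpha,\beta\}=\{\alpha_+,\alpha_-\}$ and $|\alpha|\ge|\beta|$ (either labelling if $|\alpha_+|=|\alpha_-|$). The displayed inequality is understood to include that the denominators $a_n,a_{n+1}$ occurring in it are nonzero. *)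

theory Defs imports Complex_Main begin

text \<open>The roots of \<open>x\<^sup>2 - a x + b\<close>. On negative reals, \<open>csqrt\<close> is the
  branch with positive imaginary part, see \<open>csqrt_of_real_neg\<close> below.\<close>

definition root_plus :: "real \<Rightarrow> real \<Rightarrow> complex" where
  "root_plus a b = (complex_of_real a + csqrt (complex_of_real (a\<^sup>2 - 4 * b))) / 2"

definition root_minus :: "real \<Rightarrow> real \<Rightarrow> complex" where
  "root_minus a b = (complex_of_real a - csqrt (complex_of_real (a\<^sup>2 - 4 * b))) / 2"

lemma csqrt_of_real_neg:
  assumes "a\<^sup>2 - 4 * b < 0"
  shows "csqrt (complex_of_real (a\<^sup>2 - 4 * b)) = \<i> * complex_of_real (sqrt (4 * b - a\<^sup>2))"
  using assms by (simp add: csqrt_of_real_nonpos)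

end

theory Submission imports Defs begin

text \<open>
  Write \<open>r n = s (n + 1) / s n\<close>. As \<open>r (n + 1) = a - b / r n\<close> with \<open>a = \<alpha> + \<beta>\<close> and \<open>b = \<alpha> * \<beta>\<close>,
  one step of the recurrence multiplies the error by \<open>\<beta> / r n\<close>, that is, \<open>\<alpha> - r (n + 1) = \<beta> / r n * (\<alpha> - r n)\<close>.
  Hence the error does not grow at \<open>n\<close> iff \<open>r n = \<alpha>\<close> or \<open>\<bar>\<beta>\<bar> \<le> \<bar>r n\<bar>\<close>, and up to the
  exceptional case the question is whether \<open>\<bar>s n\<bar> / \<bar>\<beta>\<bar> ^ n\<close> is eventually nonzero and
  nondecreasing.

  If the roots are real, the increments of \<open>t n = s n / \<beta> ^ n\<close> form a geometric sequence
  with ratio \<open>\<rho> = \<alpha> / \<beta>\<close>. Here \<open>\<bar>\<rho>\<bar> \<ge> 1\<close>, and \<open>\<rho> \<noteq> -1\<close> because \<open>a \<noteq> 0\<close>, so \<open>t\<close> is constant,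
  or affine in \<open>n\<close>, or a constant plus an exponentially growing term. In every case
  \<open>\<bar>t n\<bar>\<close> is eventually nondecreasing (\<open>eventually_abs_mono_of_geometric_increments\<close>).

  If the roots are not real, then \<open>r n\<close>, being real, never equals \<open>\<alpha>\<close>, and \<open>\<bar>\<beta>\<bar>\<^sup>2 = b\<close>.
  The sequence \<open>x n = (s n)\<^sup>2 / b ^ n\<close> is bounded, since the quadratic form
  \<open>(s (n + 1))\<^sup>2 - a * s n * s (n + 1) + b * (s n)\<^sup>2\<close> is positive definite and gets multiplied by \<open>b\<close> at
  each step. If \<open>x\<close> were eventually positive and nondecreasing, it would converge to a
  positive limit, and the recurrence would force \<open>a\<^sup>2 / b\<close> to be \<open>0\<close> or \<open>4\<close>. But \<open>a \<noteq> 0\<close> and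
  \<open>a\<^sup>2 < 4 * b\<close>. Geometrically, \<open>s n / b powr (n / 2)\<close> is a sampled cosine, whose modulus
  can settle only if the argument of \<open>\<alpha>\<close> is a multiple of a right angle.
\<close>

section \<open>The roots and the error of the quotients\<close>

lemma root_plus_add_root_minus: "root_plus a b + root_minus a b = complex_of_real a"
  by (simp add: root_plus_def root_minus_def field_simps)

lemma root_plus_mult_root_minus: "root_plus a b * root_minus a b = complex_of_real b"
proof -
  have "root_plus a b * root_minus a b
      = ((complex_of_real a)\<^sup>2 - (csqrt (complex_of_real (a\<^sup>2 - 4 * b)))\<^sup>2) / 4"
    by (simp add: root_plus_def root_minus_def power2_eq_square algebra_simps)
  then show ?thesis
    by simp
qed

lemma roots_real:
  assumes "a\<^sup>2 - 4 * b \<ge> 0" and "z \<in> {root_plus a b, root_minus a b}"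
  shows "z \<in> \<real>"
proof -
  have "csqrt (complex_of_real (a\<^sup>2 - 4 * b)) = complex_of_real (sqrt (a\<^sup>2 - 4 * b))"
    using assms(1) by (simp only: csqrt_of_real_nonneg Im_complex_of_real Re_complex_of_real)
  then have "root_plus a b \<in> \<real>" "root_minus a b \<in> \<real>"
    unfolding root_plus_def root_minus_def by (simp_all del: of_real_diff)
  with assms(2) show ?thesis
    by blast
qed

lemma roots_nonreal_Re_Im:
  assumes "a\<^sup>2 - 4 * b < 0" and "z \<in> {root_plus a b, root_minus a b}"
  shows "Re z = a / 2" and "(Im z)\<^sup>2 = b - a\<^sup>2 / 4"
proof -
  have "Re (root_plus a b) = a / 2" "Re (root_minus a b) = a / 2"
    "Im (root_plus a b) = sqrt (4 * b - a\<^sup>2) / 2" "Im (root_minus a b) = - (sqrt (4 * b - a\<^sup>2) / 2)"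
    unfolding root_plus_def root_minus_def csqrt_of_real_neg[OF assms(1)] by simp_all
  then have "Re z = a / 2 \<and> (Im z)\<^sup>2 = (sqrt (4 * b - a\<^sup>2) / 2)\<^sup>2"
    using assms(2) by (auto simp only: insert_iff empty_iff power2_minus)
  then show "Re z = a / 2" and "(Im z)\<^sup>2 = b - a\<^sup>2 / 4"
    using assms(1) by (auto simp: power_divide)
qed

lemma roots_not_real:
  assumes "a\<^sup>2 - 4 * b < 0" and "z \<in> {root_plus a b, root_minus a b}"
  shows "z \<notin> \<real>"
  using roots_nonreal_Re_Im(2)[OF assms] assms(1) by (auto simp: complex_is_Real_iff)

lemma cmod_roots_nonreal:
  assumes "a\<^sup>2 - 4 * b < 0" and "z \<in> {root_plus a b, root_minus a b}"
  shows "(cmod z)\<^sup>2 = b"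
  unfolding cmod_power2 roots_nonreal_Re_Im[OF assms] by (simp add: power_divide)

lemma quotient_error_step:
  fixes \<alpha> \<beta> x y z :: "'a::field"
  assumes "x \<noteq> 0" "y \<noteq> 0" "z = (\<alpha> + \<beta>) * y - \<alpha> * \<beta> * x"
  shows "\<alpha> - z / y = \<beta> * x / y * (\<alpha> - y / x)"
  unfolding assms(3) using assms(1,2) by (simp add: field_simps)

lemma quotient_error_nonincreasing_iff:
  fixes \<alpha> \<beta> x y z :: "'a::real_normed_field"
  assumes "x \<noteq> 0" "y \<noteq> 0" "z = (\<alpha> + \<beta>) * y - \<alpha> * \<beta> * x"
  shows "norm (\<alpha> - z / y) \<le> norm (\<alpha> - y / x) \<longleftrightarrow> \<alpha> = y / x \<or> norm \<beta> * norm x \<le> norm y"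
proof (cases "\<alpha> = y / x")
  case True
  then show ?thesis
    using quotient_error_step[OF assms] by simp
next
  case False
  then have "norm (\<alpha> - y / x) > 0"
    by simp
  then have "norm \<beta> * norm x / norm y * norm (\<alpha> - y / x) \<le> norm (\<alpha> - y / x)
      \<longleftrightarrow> norm \<beta> * norm x / norm y \<le> 1"
    by (metis mult_le_cancel_right_pos mult_1)
  then show ?thesis
    using False assms(2) unfolding quotient_error_step[OF assms]
    by (simp add: norm_mult norm_divide divide_le_eq)
qed

section \<open>Real roots\<close>

text \<open>
  For \<open>\<rho> = 1\<close> the sequence is affine in \<open>n\<close>. Otherwise \<open>t n = C + K * \<rho> ^ n\<close> with \<open>\<bar>\<rho>\<bar> > 1\<close>,
  and the second term dominates unless \<open>K = 0\<close>. The value \<open>\<rho> = -1\<close> has to be avoided: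
  there \<open>t\<close> alternates between two values, in general of different modulus.
\<close>

lemma eventually_abs_mono_of_geometric_increments:
  fixes t :: "nat \<Rightarrow> real" and \<rho> k :: real
  assumes step: "\<And>n. t (Suc n) - t n = k * \<rho> ^ n"
    and rho: "\<bar>\<rho>\<bar> \<ge> 1" "\<rho> \<noteq> -1"
    and nz: "t 0 \<noteq> 0 \<or> k \<noteq> 0"
  shows "\<forall>\<^sub>F n in sequentially. t n \<noteq> 0 \<and> \<bar>t n\<bar> \<le> \<bar>t (Suc n)\<bar>"
proof (cases "k = 0")
  case True
  then have const: "t n = t 0" for n
    using step by (induction n) auto
  have "t n \<noteq> 0 \<and> \<bar>t n\<bar> \<le> \<bar>t (Suc n)\<bar>" for n
    using const[of n] const[of "Suc n"] nz True by linarith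
  then show ?thesis
    by (intro always_eventually allI)
next
  case k: False
  show ?thesis
  proof (cases "\<rho> = 1")
    case True
    have t: "t n = t 0 + k * real n" for n
    proof (induction n)
      case (Suc n)
      then show ?case
        using step[of n] True by (simp add: algebra_simps)
    qed simp
    have "\<forall>\<^sub>F n in sequentially. real n > \<bar>t 0\<bar> / \<bar>k\<bar>"
      using filterlim_real_sequentially eventually_compose_filterlim[OF eventually_gt_at_top]
      by blast
    then show ?thesis
    proof eventually_elim
      case (elim n)
      then have "\<bar>t 0\<bar> < \<bar>k\<bar> * real n"
        using k by (simp add: divide_less_eq mult.commute)
      then show ?case
        using k unfolding t[of n] t[of "Suc n"]
        by (cases "k > 0") (auto simp: abs_if algebra_simps split: if_splits)
    qed
  next
    case False
    with rho have rho1: "\<bar>\<rho>\<bar> > 1"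
      by (auto simp: abs_if split: if_splits)
    define K where "K = k / (\<rho> - 1)"
    define C where "C = t 0 - K"
    have "K * (\<rho> - 1) = k"
      using False by (simp add: K_def)
    then have K: "K \<noteq> 0" "K * \<rho> - K = k"
      using k by (auto simp: algebra_simps)
    have t: "t n = C + K * \<rho> ^ n" for n
    proof (induction n)
      case 0
      then show ?case by (simp add: C_def)
    next
      case (Suc n)
      have "t (Suc n) = C + K * \<rho> ^ n + (K * \<rho> - K) * \<rho> ^ n"
        using step[of n] Suc K(2) by simp
      then show ?case
        by (simp add: algebra_simps)
    qed
    \<comment> \<open>The second factor of \<open>t (n + 1)\<^sup>2 - (t n)\<^sup>2 = (t (n + 1) - t n) * (t (n + 1) + t n)\<close> is
      \<open>2 * C + K * (\<rho> + 1) * \<rho> ^ n\<close>, whose leading coefficient does not vanish.\<close>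
    define M where "M = max (\<bar>C\<bar> / \<bar>K\<bar>) (2 * \<bar>C\<bar> / \<bar>K * (\<rho> + 1)\<bar>)"
    obtain N where N: "M < \<bar>\<rho>\<bar> ^ N"
      using real_arch_pow[OF rho1] by blast
    have "M < \<bar>\<rho>\<bar> ^ n" if "n \<ge> N" for n
      using N power_increasing[OF that rho(1)] by linarith
    then have "\<forall>\<^sub>F n in sequentially. \<bar>\<rho>\<bar> ^ n > M"
      unfolding eventually_sequentially by blast
    then show ?thesis
    proof eventually_elim
      case (elim n)
      have 1: "\<bar>C\<bar> < \<bar>K * \<rho> ^ n\<bar>"
        using elim K(1) by (simp add: M_def divide_less_eq abs_mult power_abs mult.commute)
      have r1: "\<rho> + 1 \<noteq> 0"
        using rho(2) by linarith
      have "2 * \<bar>C\<bar> / \<bar>K * (\<rho> + 1)\<bar> < \<bar>\<rho>\<bar> ^ n"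
        using elim by (simp add: M_def)
      moreover have "\<bar>K * (\<rho> + 1)\<bar> > 0"
        using K(1) r1 by simp
      ultimately have "2 * \<bar>C\<bar> < \<bar>\<rho>\<bar> ^ n * \<bar>K * (\<rho> + 1)\<bar>"
        by (metis divide_less_eq)
      also have "\<dots> = \<bar>K * \<rho> ^ n * (\<rho> + 1)\<bar>"
        by (simp add: abs_mult power_abs)
      finally have 2: "\<bar>2 * C\<bar> < \<bar>K * \<rho> ^ n * (\<rho> + 1)\<bar>"
        by (simp add: abs_mult)
      define y where "y = K * \<rho> ^ n"
      have "(t (Suc n))\<^sup>2 - (t n)\<^sup>2 = (\<rho> - 1) * (2 * C * y + (\<rho> + 1) * y\<^sup>2)"
        unfolding t y_def by (simp add: power2_eq_square algebra_simps)
      also have "\<dots> = ((\<rho> - 1) / (\<rho> + 1)) * (2 * C * (y * (\<rho> + 1)) + (y * (\<rho> + 1))\<^sup>2)"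
        using r1 by (simp add: power2_eq_square field_simps)
      also have "\<dots> \<ge> 0"
      proof (rule mult_nonneg_nonneg)
        have "\<rho> > 1 \<or> \<rho> < -1"
          using rho1 by (auto simp: abs_if split: if_splits)
        then show "(\<rho> - 1) / (\<rho> + 1) \<ge> 0"
          by (auto simp: zero_le_divide_iff)
        have "\<bar>2 * C * (y * (\<rho> + 1))\<bar> \<le> \<bar>y * (\<rho> + 1)\<bar> * \<bar>y * (\<rho> + 1)\<bar>"
          using 2 unfolding abs_mult[of "2 * C"] y_def by (intro mult_right_mono) auto
        then show "2 * C * (y * (\<rho> + 1)) + (y * (\<rho> + 1))\<^sup>2 \<ge> 0"
          by (simp add: power2_eq_square abs_le_iff)
      qed
      finally have "\<bar>t n\<bar> \<le> \<bar>t (Suc n)\<bar>"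
        by (simp add: abs_le_square_iff)
      moreover have "t n \<noteq> 0"
        using 1 unfolding t by linarith
      ultimately show ?case
        by simp
    qed
  qed
qed

lemma recurrence_real_roots_eventually:
  fixes s :: "nat \<Rightarrow> real" and p q :: real
  assumes rec: "\<And>n. s (n + 2) = (p + q) * s (n + 1) - p * q * s n"
    and nz: "s 0 \<noteq> 0 \<or> s 1 \<noteq> 0"
    and q: "q \<noteq> 0" and pq: "\<bar>q\<bar> \<le> \<bar>p\<bar>" "p + q \<noteq> 0"
  shows "\<forall>\<^sub>F n in sequentially. s n \<noteq> 0 \<and> \<bar>q\<bar> * \<bar>s n\<bar> \<le> \<bar>s (Suc n)\<bar>"
proof -
  define t where "t n = s n / q ^ n" for n
  \<comment> \<open>Factoring the shift operator as \<open>(E - p) * (E - q)\<close> shows that \<open>(E - q) s\<close> is geometric.\<close>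
  have d: "s (Suc n) - q * s n = (s 1 - q * s 0) * p ^ n" for n
  proof (induction n)
    case (Suc n)
    have "s (Suc (Suc n)) - q * s (Suc n) = p * (s (Suc n) - q * s n)"
      using rec[of n] by (simp add: algebra_simps)
    then show ?case
      using Suc by simp
  qed simp
  have "t (Suc n) - t n = (s 1 - q * s 0) / q * (p / q) ^ n" for n
  proof -
    have "t (Suc n) - t n = (s (Suc n) - q * s n) / q ^ Suc n"
      using q by (simp add: t_def field_simps)
    then show ?thesis
      unfolding d by (simp add: power_divide)
  qed
  moreover have "\<bar>p / q\<bar> \<ge> 1" "p / q \<noteq> -1"
    using q pq by (auto simp: field_simps)
  moreover have "t 0 \<noteq> 0 \<or> (s 1 - q * s 0) / q \<noteq> 0"
    using nz q by (auto simp: t_def)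
  ultimately have "\<forall>\<^sub>F n in sequentially. t n \<noteq> 0 \<and> \<bar>t n\<bar> \<le> \<bar>t (Suc n)\<bar>"
    by (rule eventually_abs_mono_of_geometric_increments)
  then show ?thesis
  proof eventually_elim
    case (elim n)
    have "\<bar>q\<bar> ^ Suc n > 0"
      using q by simp
    then have "\<bar>q\<bar> ^ Suc n * \<bar>t n\<bar> \<le> \<bar>q\<bar> ^ Suc n * \<bar>t (Suc n)\<bar>"
      using elim by (intro mult_left_mono) auto
    then show ?case
      using elim q by (simp add: t_def abs_divide abs_mult power_abs)
  qed
qed

section \<open>Nonreal roots\<close>

text \<open>
  For a nondecreasing \<open>(s n)\<^sup>2 / b ^ n\<close> with limit \<open>L > 0\<close>, squaring
  \<open>s (n + 2) + b * s n = a * s (n + 1)\<close> gives two relations between squares and the product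
  \<open>s n * s (n + 2)\<close>. Eliminating this product leaves a relation between squares alone, whose
  limit is \<open>4 * L\<^sup>2 = (a\<^sup>2 / b - 2)\<^sup>2 * L\<^sup>2\<close>.
\<close>

lemma recurrence_nonreal_roots_not_eventually:
  fixes s :: "nat \<Rightarrow> real" and a b :: real
  assumes rec: "\<And>n. s (n + 2) = a * s (n + 1) - b * s n"
    and a: "a \<noteq> 0" and disc: "a\<^sup>2 < 4 * b"
  shows "\<not> (\<forall>\<^sub>F n in sequentially. s n \<noteq> 0 \<and> b * (s n)\<^sup>2 \<le> (s (Suc n))\<^sup>2)"
proof
  assume "\<forall>\<^sub>F n in sequentially. s n \<noteq> 0 \<and> b * (s n)\<^sup>2 \<le> (s (Suc n))\<^sup>2"
  then obtain N where N: "\<And>n. n \<ge> N \<Longrightarrow> s n \<noteq> 0 \<and> b * (s n)\<^sup>2 \<le> (s (Suc n))\<^sup>2"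
    unfolding eventually_sequentially by blast
  have "a\<^sup>2 > 0"
    using a by simp
  then have b: "b > 0"
    using disc by linarith
  define Q where "Q n = (s (Suc n))\<^sup>2 - a * s n * s (Suc n) + b * (s n)\<^sup>2" for n
  define x where "x n = (s (n + N))\<^sup>2 / b ^ (n + N)" for n
  define c where "c = b - a\<^sup>2 / 4"
  have c: "c > 0"
    using disc by (simp add: c_def)
  have Q: "Q n = b ^ n * Q 0" for n
  proof (induction n)
    case (Suc n)
    have "Q (Suc n) = b * Q n"
      unfolding Q_def using rec[of n] by (simp only: add_2_eq_Suc' Suc_eq_plus1[symmetric]) (simp add: power2_eq_square algebra_simps)
    then show ?case
      using Suc by simp
  qed simp
  have lower: "c * (s n)\<^sup>2 \<le> b ^ n * Q 0" for n
  proof -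
    have "Q n = c * (s n)\<^sup>2 + (s (Suc n) - a / 2 * s n)\<^sup>2"
      by (simp add: Q_def c_def power2_eq_square algebra_simps)
    then show ?thesis
      unfolding Q[symmetric] by simp
  qed
  have upper: "x n \<le> Q 0 / c" for n
    using lower[of "n + N"] b c by (simp add: x_def field_simps)
  have "x n \<le> x (Suc n)" for n
    using N[of "n + N"] b by (simp add: x_def field_simps)
  then have inc: "incseq x"
    by (rule incseq_SucI)
  then obtain L where L: "x \<longlonglongrightarrow> L" and below: "\<And>n. x n \<le> L"
    using upper incseq_convergent by blast
  have "x 0 > 0"
    using N[of N] b by (simp add: x_def)
  then have "L > 0"
    using below[of 0] by linarith
  have rel: "4 * x n * x (n + 2) = (a\<^sup>2 / b * x (n + 1) - x n - x (n + 2))\<^sup>2" for n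
  proof -
    define m where "m = n + N"
    have pos: "b ^ m > 0"
      using b by simp
    have "(a * s (m + 1))\<^sup>2 = (s (m + 2) + b * s m)\<^sup>2"
      using rec[of m] by simp
    then have "a\<^sup>2 * (s (m + 1))\<^sup>2 - b\<^sup>2 * (s m)\<^sup>2 - (s (m + 2))\<^sup>2 = 2 * b * s m * s (m + 2)"
      by (simp add: power2_eq_square algebra_simps)
    moreover have "a\<^sup>2 / b * x (n + 1) - x n - x (n + 2)
        = (a\<^sup>2 * (s (m + 1))\<^sup>2 - b\<^sup>2 * (s m)\<^sup>2 - (s (m + 2))\<^sup>2) / b ^ (m + 2)"
      using b by (simp add: x_def m_def field_simps power2_eq_square)
    ultimately have "(a\<^sup>2 / b * x (n + 1) - x n - x (n + 2))\<^sup>2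
        = (2 * b * s m * s (m + 2) / b ^ (m + 2))\<^sup>2"
      by simp
    also have "\<dots> = 4 * x n * x (n + 2)"
      using b by (simp add: x_def m_def field_simps power2_eq_square)
    finally show ?thesis by simp
  qed
  have L1: "(\<lambda>n. x (n + 1)) \<longlonglongrightarrow> L" and L2: "(\<lambda>n. x (n + 2)) \<longlonglongrightarrow> L"
    using L by (rule LIMSEQ_ignore_initial_segment)+
  have "(\<lambda>n. 4 * x n * x (n + 2)) \<longlonglongrightarrow> 4 * L * L"
    by (intro tendsto_intros L L2)
  moreover have "(\<lambda>n. (a\<^sup>2 / b * x (n + 1) - x n - x (n + 2))\<^sup>2) \<longlonglongrightarrow> (a\<^sup>2 / b * L - L - L)\<^sup>2"
    by (intro tendsto_intros L L1 L2)
  ultimately have "4 * L * L = (a\<^sup>2 / b * L - L - L)\<^sup>2"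
    unfolding rel by (rule LIMSEQ_unique)
  then have "L\<^sup>2 * (a\<^sup>2 / b) * (a\<^sup>2 / b - 4) = 0"
    by (simp add: power2_eq_square algebra_simps)
  then have "a\<^sup>2 / b = 4"
    using \<open>L > 0\<close> a b by simp
  then show False
    using disc b by (simp add: field_simps)
qed

section \<open>Monotone convergence of the quotients\<close>

theorem theorem1p4:
  fixes a b c0 c1 :: real and s :: "nat \<Rightarrow> real" and \<alpha> \<beta> :: complex
  assumes "a * b \<noteq> 0"
    and "(c0, c1) \<noteq> (0, 0)"
    and "s 0 = c0"
    and "s 1 = c1"
    and "\<And>n. s (n + 2) - a * s (n + 1) + b * s n = 0"
    and "{\<alpha>, \<beta>} = {root_plus a b, root_minus a b}"
    and "cmod \<alpha> \<ge> cmod \<beta>"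
  shows "(\<exists>n0. \<forall>n\<ge>n0. s n \<noteq> 0 \<and> s (n + 1) \<noteq> 0 \<and>
            cmod (\<alpha> - complex_of_real (s (n + 1) / s n))
              \<ge> cmod (\<alpha> - complex_of_real (s (n + 2) / s (n + 1))))
         \<longleftrightarrow> a\<^sup>2 - 4 * b \<ge> 0"
    (is "?mono \<longleftrightarrow> _")
proof -
  have ab: "a \<noteq> 0" "b \<noteq> 0"
    using assms(1) by auto
  have rec: "s (n + 2) = a * s (n + 1) - b * s n" for n
    using assms(5)[of n] by simp
  have sum: "\<alpha> + \<beta> = complex_of_real a" and prod: "\<alpha> * \<beta> = complex_of_real b"
    using assms(6) root_plus_add_root_minus[of a b] root_plus_mult_root_minus[of a b]
    by (auto simp: doubleton_eq_iff add.commute mult.commute)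
  have step: "cmod (\<alpha> - complex_of_real (s (n + 1) / s n))
                \<ge> cmod (\<alpha> - complex_of_real (s (n + 2) / s (n + 1)))
      \<longleftrightarrow> \<alpha> = complex_of_real (s (n + 1) / s n) \<or> cmod \<beta> * \<bar>s n\<bar> \<le> \<bar>s (n + 1)\<bar>"
    if "s n \<noteq> 0" "s (n + 1) \<noteq> 0" for n
  proof -
    have "complex_of_real (s (n + 2))
        = (\<alpha> + \<beta>) * complex_of_real (s (n + 1)) - \<alpha> * \<beta> * complex_of_real (s n)"
      unfolding sum prod rec by simp
    from quotient_error_nonincreasing_iff[OF _ _ this] that show ?thesis
      by simp
  qed
  show ?thesis
  proof (cases "a\<^sup>2 - 4 * b \<ge> 0")
    case True
    have "\<alpha> \<in> \<real>" "\<beta> \<in> \<real>"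
      using roots_real[OF True] assms(6) by blast+
    then obtain p q where pq: "\<alpha> = complex_of_real p" "\<beta> = complex_of_real q"
      by (auto elim!: Reals_cases)
    have "p + q = a" "p * q = b"
      using sum prod unfolding pq by (simp_all flip: of_real_add of_real_mult)
    then have ev: "\<forall>\<^sub>F n in sequentially. s n \<noteq> 0 \<and> \<bar>q\<bar> * \<bar>s n\<bar> \<le> \<bar>s (Suc n)\<bar>"
      using ab rec assms(2-4,7) unfolding pq
      by (intro recurrence_real_roots_eventually[where p = p]) auto
    then have "\<forall>\<^sub>F n in sequentially. s (Suc n) \<noteq> 0"
      by (subst eventually_sequentially_Suc) (auto elim: eventually_mono)
    with ev have ?mono
      unfolding eventually_sequentially[symmetric]
    proof eventually_elim
      case (elim n)
      then show ?case
        using step[of n] by (simp add: pq)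
    qed
    with True show ?thesis by blast
  next
    case False
    then have disc: "a\<^sup>2 - 4 * b < 0"
      by simp
    have "\<not> ?mono"
    proof
      assume ?mono
      then have "\<forall>\<^sub>F n in sequentially. s n \<noteq> 0 \<and> b * (s n)\<^sup>2 \<le> (s (Suc n))\<^sup>2"
        unfolding eventually_sequentially[symmetric]
      proof eventually_elim
        case (elim n)
        have "\<alpha> \<notin> \<real>"
          using roots_not_real[OF disc] assms(6) by blast
        then have "cmod \<beta> * \<bar>s n\<bar> \<le> \<bar>s (n + 1)\<bar>"
          using elim step[of n] by (metis Reals_of_real)
        then have "(cmod \<beta> * \<bar>s n\<bar>)\<^sup>2 \<le> \<bar>s (n + 1)\<bar>\<^sup>2"
          by (intro power_mono) auto
        moreover have "(cmod \<beta>)\<^sup>2 = b"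
          using cmod_roots_nonreal[OF disc] assms(6) by blast
        ultimately show ?case
          using elim by (simp add: power_mult_distrib)
      qed
      then show False
        using recurrence_nonreal_roots_not_eventually[OF rec] ab disc by simp
    qed
    with False show ?thesis by blast
  qed
qed

end
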